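(* Let $s>0$. Then for all $n\ge2$, $$\delta_n(\rho^*(s))\le 2^{-6s}\,n^{-s}\,n^{\frac{4s\sqrt{4+\log_2 n}}{\log_2 n}},$$ and thus $$E_n(\mathcal{U}_{\rho^*(s),1})\le 2^{-6s}\,n^{-s}\,n^{\frac{4s\sqrt{4+\log_2 n}}{\log_2 n}}.$$
   Context: $X$ is a Banach space, $\mathbb{N}_0=\{0,1,2,\dots\}$, $Y=[-1,1]^{\mathbb{N}}$. $\mathcal{F}$ is the set of all sequences $\nu=(\nu_1,\nu_2,\dots)$ with entries in $\mathbb{N}_0$ and only finitely many nonzero entries; $y^\nu=\prod_jy_j^{\nu_j}$, $\rho^\nu=\prod_j\rho_j^{\nu_j}$, $\rho^{-\nu}=1/\rho^\nu$. $L_\infty(Y,X)$ is the space of bounded maps $v:Y\to X$ with the sup norm. Let $I_1=\{1,2\}$ and $I_k=\{j\in\mathbb{N}:2^{k-1}<j\le2^k\}$ for $k\ge2$. For $s>0$, $\rho^*(s)$ is the sequence with $\rho^*_j(s)=2^{ks}$ for $j\in I_k$, $k\ge1$. For a nondecreasing sequence $\rho$ with $\rho_1>1$, $\rho_j\to\infty$, $(\delta_n(\rho))_{n\ge1}$ is the decreasing rearrangement (with repetitions) of $(\rho^{-\nu})_{\nu\in\mathcal{F}}$. $\mathcal{B}_{\rho,p}$ ($0<p\le\infty$) is the set of $u\in L_\infty(Y,X)$ which admit a representation $u(y)=\sum_{\nu\in\mathcal{F}}t_\nu y^\nu$, $y\in Y$, with unique $t_\nu\in X$, where the series converges uniformly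 unconditionally on $Y$ (any rearrangement converges in $X$ to $u$, uniformly on $Y$), and $\|u\|_{\mathcal{B}_{\rho,p}}:=\|(\rho^\nu\|t_\nu\|_X)_{\nu\in\mathcal{F}}\|_{\ell_p(\mathcal{F})}<\infty$. $\mathcal{U}_{\rho,p}=\{u:\|u\|_{\mathcal{B}_{\rho,p}}\le1\}$. A set $\Lambda\subset\mathcal{F}$ is a lower set if $\nu\in\Lambda$ and $\mu\in\mathcal{F}$, $\mu_j\le\nu_j$ for all $j$, imply $\mu\in\Lambda$. $\mathcal{L}_n$ is the collection of lower sets with $\#\Lambda\le n$; $\mathcal{P}_\Lambda=\{\sum_{\nu\in\Lambda}c_\nu y^\nu:c_\nu\in X\}$; and $E_n(K)=\inf_{\Lambda\in\mathcal{L}_n}\sup_{u\in K}\inf_{P\in\mathcal{P}_\Lambda}\|u-P\|_{L_\infty(Y,X)}$. *)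

theory Defs
  imports "HOL-Analysis.Analysis" "HOL-Library.Poly_Mapping"
begin

text \<open>Coordinates are numbered from 0: index \<open>j\<close> here stands for coordinate \<open>j + 1\<close> of a
  sequence indexed by 1, 2, 3, and so on.  The set of finitely supported multi-indices is the
  type of finitely supported functions from nat to nat.\<close>

type_synonym multi_index = "nat \<Rightarrow>\<^sub>0 nat"

definition Y :: "(nat \<Rightarrow> real) set" where
  "Y = {y. \<forall>j. y j \<in> {-1..1}}"

definition mpow :: "(nat \<Rightarrow> real) \<Rightarrow> multi_index \<Rightarrow> real" where
  "mpow y \<nu> = (\<Prod>j\<in>Poly_Mapping.keys \<nu>. y j ^ Poly_Mapping.lookup \<nu> j)"

definition block :: "nat \<Rightarrow> nat set" where
  "block k = (if k = 1 then {1, 2} else {j. 2 ^ (k - 1) < j \<and> j \<le> 2 ^ k})"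

text \<open>The blocks consist of one-based positions, hence the \<open>Suc\<close>.\<close>

definition rho_star :: "real \<Rightarrow> nat \<Rightarrow> real" where
  "rho_star s j = 2 powr (real (THE k. 1 \<le> k \<and> Suc j \<in> block k) * s)"

text \<open>The value at \<open>n \<ge> 1\<close> does not depend on how ties are broken by the enumeration \<open>e\<close>; an
  enumeration exists whenever \<open>\<rho>\<close> is nondecreasing, exceeds 1 and tends to infinity.\<close>

definition delta :: "(nat \<Rightarrow> real) \<Rightarrow> nat \<Rightarrow> real" where
  "delta \<rho> n = (THE x. \<exists>e :: nat \<Rightarrow> multi_index. bij_betw e {1..} UNIV \<and>
     (\<forall>i j. 1 \<le> i \<longrightarrow> i \<le> j \<longrightarrow> 1 / mpow \<rho> (e j) \<le> 1 / mpow \<rho> (e i)) \<and>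
     x = 1 / mpow \<rho> (e n))"

definition lp_norm :: "ennreal \<Rightarrow> ('i \<Rightarrow> real) \<Rightarrow> ennreal" where
  "lp_norm p a =
     (if p = \<infinity> then (SUP i. ennreal \<bar>a i\<bar>)
      else let S = (\<Sum>\<^sub>\<infinity>i. ennreal (\<bar>a i\<bar> powr enn2real p))
           in if S = \<infinity> then \<infinity> else ennreal (enn2real S powr (1 / enn2real p)))"

text \<open>Uniform unconditional convergence on \<open>Y\<close>: every enumeration of the multi-indices gives
  partial sums converging to \<open>u\<close> uniformly on \<open>Y\<close>.\<close>

definition represents ::
    "(multi_index \<Rightarrow> 'a::banach) \<Rightarrow> ((nat \<Rightarrow> real) \<Rightarrow> 'a) \<Rightarrow> bool" where
  "represents t u \<longleftrightarrow> (\<forall>e :: nat \<Rightarrow> multi_index. bij e \<longrightarrow>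
     uniform_limit Y (\<lambda>n y. \<Sum>i<n. mpow y (e i) *\<^sub>R t (e i)) u sequentially)"

text \<open>Maps on \<open>Y\<close> are total functions of which only the restriction to \<open>Y\<close> is ever used.\<close>

definition B_norm :: "(nat \<Rightarrow> real) \<Rightarrow> ennreal \<Rightarrow> ((nat \<Rightarrow> real) \<Rightarrow> 'a::banach) \<Rightarrow> ennreal" where
  "B_norm \<rho> p u = lp_norm p (\<lambda>\<nu>. mpow \<rho> \<nu> * norm ((THE t. represents t u) \<nu>))"

definition B_space :: "(nat \<Rightarrow> real) \<Rightarrow> ennreal \<Rightarrow> ((nat \<Rightarrow> real) \<Rightarrow> 'a::banach) set" where
  "B_space \<rho> p = {u. bounded (u ` Y) \<and> (\<exists>!t. represents t u) \<and> B_norm \<rho> p u < \<infinity>}"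

definition U_ball :: "(nat \<Rightarrow> real) \<Rightarrow> ennreal \<Rightarrow> ((nat \<Rightarrow> real) \<Rightarrow> 'a::banach) set" where
  "U_ball \<rho> p = {u \<in> B_space \<rho> p. B_norm \<rho> p u \<le> 1}"

definition lower_set :: "multi_index set \<Rightarrow> bool" where
  "lower_set \<Lambda> \<longleftrightarrow>
     (\<forall>\<nu>\<in>\<Lambda>. \<forall>\<mu>. (\<forall>j. Poly_Mapping.lookup \<mu> j \<le> Poly_Mapping.lookup \<nu> j) \<longrightarrow> \<mu> \<in> \<Lambda>)"

definition lower_sets :: "nat \<Rightarrow> multi_index set set" where
  "lower_sets n = {\<Lambda>. lower_set \<Lambda> \<and> finite \<Lambda> \<and> card \<Lambda> \<le> n}"

definition poly_space :: "multi_index set \<Rightarrow> ((nat \<Rightarrow> real) \<Rightarrow> 'a::banach) set" where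
  "poly_space \<Lambda> = {P. \<exists>c. P = (\<lambda>y. \<Sum>\<nu>\<in>\<Lambda>. mpow y \<nu> *\<^sub>R c \<nu>)}"

definition sup_norm :: "((nat \<Rightarrow> real) \<Rightarrow> 'a::banach) \<Rightarrow> ennreal" where
  "sup_norm v = (SUP y\<in>Y. ennreal (norm (v y)))"

text \<open>Extended values, because the supremum over an arbitrary class \<open>K\<close> may be infinite.\<close>

definition E_width :: "nat \<Rightarrow> ((nat \<Rightarrow> real) \<Rightarrow> 'a::banach) set \<Rightarrow> ennreal" where
  "E_width n K =
     (INF \<Lambda>\<in>lower_sets n. SUP u\<in>K. INF P\<in>poly_space \<Lambda>. sup_norm (\<lambda>y. u y - P y))"

end

theory Submission
  imports Defs "HOL-Library.Discrete_Functions"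
begin

text \<open>Since \<open>\<rho>\<^sup>*(s)\<close> to the power \<open>\<nu>\<close> equals \<open>2\<close> to the power \<open>s w(\<nu>)\<close>, where \<open>w(\<nu>)\<close> counts each
  entry in block \<open>I\<^sub>k\<close> with weight \<open>k\<close>, the bound on \<open>\<delta>\<^sub>n\<close> amounts to counting the multi-indices of
  weight at most \<open>m\<close>.  Their number is at most \<open>z\<close> to the power \<open>-m\<close> times the generating function of \<open>w\<close> at
  \<open>z < 1/2\<close>; with \<open>q = \<surd>(m + 2)\<close> and \<open>z = q / (2 (q + 1))\<close> this is at most \<open>2\<close> to the power
  \<open>m + 2 + 4 q\<close>, which is the claim after completing the square: with \<open>x = \<surd>(4 + log\<^sub>2 n)\<close> it reads
  \<open>x \<le> q + 2\<close>, whereas the claimed exponent is \<open>(x - 2)\<^sup>2 - 2 \<le> m\<close>.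
  The bound on \<open>E\<^sub>n\<close> follows by truncating the expansion of \<open>u\<close> to the multi-indices of weight below that
  of the \<open>n\<close>-th one.\<close>

section \<open>Sorted enumerations and counting functions\<close>

text \<open>Greedy choice: always pick a minimiser of \<open>f\<close> among the elements not yet
  picked. An element that is never picked would bound \<open>f\<close> on the infinite range of
  \<open>e\<close>, contradicting the finiteness of the sublevel sets.\<close>

lemma sorted_enumeration_exists:
  fixes f :: "'a \<Rightarrow> nat"
  assumes fin: "\<And>m. finite {x. f x \<le> m}" and inf: "infinite (UNIV :: 'a set)"
  obtains e :: "nat \<Rightarrow> 'a" where "bij e" "\<And>i j. i \<le> j \<Longrightarrow> f (e i) \<le> f (e j)"
proof -
  define pick where "pick A = (ARG_MIN f x. x \<notin> A)" for A
  \<comment> \<open>\<open>F n\<close> is the set of the first \<open>n\<close> picks; recursing on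
    this set makes each pick depend on all earlier ones.\<close>
  define F where "F = rec_nat {} (\<lambda>_ A. insert (pick A) A)"
  have F0: "F 0 = {}" and FS: "F (Suc n) = insert (pick (F n)) (F n)" for n
    by (simp_all add: F_def)
  define e where "e n = pick (F n)" for n
  have finF: "finite (F n)" for n by (induction n) (auto simp: F0 FS)
  have ex: "\<exists>x. x \<notin> F n" for n using finF[of n] inf ex_new_if_finite by blast
  have new: "e n \<notin> F n" for n
    unfolding e_def pick_def using ex[of n] by (metis arg_min_natI)
  have least: "f (e n) \<le> f x" if "x \<notin> F n" for n x
    unfolding e_def pick_def using that by (rule arg_min_nat_le)
  have mono: "F i \<subseteq> F j" if "i \<le> j" for i j
    using that by (induction rule: dec_induct) (auto simp: FS)
  have sorted: "f (e i) \<le> f (e j)" if "i \<le> j" for i j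
    using least new mono[OF that] by blast
  have eF: "e i \<in> F j" if "i < j" for i j
    using mono[of "Suc i" j] that by (auto simp: FS e_def)
  have "inj e"
    by (rule injI) (metis eF linorder_neqE_nat new)
  moreover have "\<exists>n. e n = x" for x
  proof (rule ccontr)
    assume no: "\<nexists>n. e n = x"
    have "x \<notin> F n" for n
      by (induction n) (use no in \<open>auto simp: F0 FS e_def\<close>)
    then have "range e \<subseteq> {y. f y \<le> f x}" using least by blast
    then have "finite (range e)" using fin finite_subset by blast
    then show False using \<open>inj e\<close> finite_imageD by blast
  qed
  ultimately have "bij e" by (metis bijI surjI surj_def)
  then show thesis using that sorted by blast
qed

text \<open>The counting function of the sublevel sets determines the \<open>n\<close>-th value, so
  this value does not depend on how ties are broken. It also converts bounds on cardinalities into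
  bounds on the \<open>n\<close>-th value and back.\<close>

lemma sorted_enumeration_le_iff:
  fixes f :: "'a \<Rightarrow> nat" and e :: "nat \<Rightarrow> 'a"
  assumes e: "bij_betw e {1..} UNIV"
    and sorted: "\<And>i j. 1 \<le> i \<Longrightarrow> i \<le> j \<Longrightarrow> f (e i) \<le> f (e j)"
    and fin: "finite {x. f x \<le> m}" and n: "1 \<le> n"
  shows "f (e n) \<le> m \<longleftrightarrow> n \<le> card {x. f x \<le> m}"
proof
  assume le: "f (e n) \<le> m"
  have "inj_on e {1..n}" using e by (meson atLeastAtMost_iff atLeast_iff bij_betw_def inj_on_subset subsetI)
  then have "n = card (e ` {1..n})" by (simp add: card_image)
  also have "\<dots> \<le> card {x. f x \<le> m}"
    by (rule card_mono[OF fin]) (use le sorted order_trans in \<open>fastforce\<close>)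
  finally show "n \<le> card {x. f x \<le> m}" .
next
  assume le: "n \<le> card {x. f x \<le> m}"
  show "f (e n) \<le> m"
  proof (rule ccontr)
    assume gt: "\<not> f (e n) \<le> m"
    \<comment> \<open>By sortedness, nothing from position \<open>n\<close> on has value at most
      \<open>m\<close>, which leaves only \<open>n - 1\<close> positions.\<close>
    have "x \<in> e ` {1..<n}" if "f x \<le> m" for x
    proof -
      obtain i where i: "1 \<le> i" "x = e i"
        using e unfolding bij_betw_def by (metis UNIV_I atLeast_iff imageE)
      have "i < n" using sorted[OF n, of i] i gt that by force
      then show ?thesis using i by simp
    qed
    then have "card {x. f x \<le> m} \<le> card (e ` {1..<n})"
      by (intro card_mono) auto
    also have "\<dots> \<le> n - 1" using card_image_le[of "{1..<n}" e] by simp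
    finally show False using le n by linarith
  qed
qed

section \<open>Weights of multi-indices and counting by weight\<close>

definition weight :: "(nat \<Rightarrow> nat) \<Rightarrow> multi_index \<Rightarrow> nat" where
  "weight c \<nu> = (\<Sum>j\<in>Poly_Mapping.keys \<nu>. c j * Poly_Mapping.lookup \<nu> j)"

lemma weight_eq_sum:
  assumes "finite A" "Poly_Mapping.keys \<nu> \<subseteq> A"
  shows "weight c \<nu> = (\<Sum>j\<in>A. c j * Poly_Mapping.lookup \<nu> j)"
  unfolding weight_def
  by (rule sum.mono_neutral_left) (use assms in \<open>auto simp: in_keys_iff\<close>)

lemma weight_add_single:
  "weight c (\<nu> + Poly_Mapping.single j 1) = weight c \<nu> + c j"
proof -
  let ?A = "insert j (Poly_Mapping.keys \<nu>)"
  have "weight c (\<nu> + Poly_Mapping.single j 1)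
      = (\<Sum>i\<in>?A. c i * Poly_Mapping.lookup (\<nu> + Poly_Mapping.single j 1) i)"
    by (rule weight_eq_sum) (use keys_add[of \<nu> "Poly_Mapping.single j 1"] in auto)
  also have "\<dots> = (\<Sum>i\<in>?A. c i * Poly_Mapping.lookup \<nu> i + (if j = i then c i else 0))"
    by (rule sum.cong) (auto simp: lookup_add lookup_single when_def algebra_simps)
  also have "\<dots> = (\<Sum>i\<in>?A. c i * Poly_Mapping.lookup \<nu> i) + c j"
    by (subst sum.distrib) (simp add: sum.delta')
  also have "(\<Sum>i\<in>?A. c i * Poly_Mapping.lookup \<nu> i) = weight c \<nu>"
    by (rule weight_eq_sum[symmetric]) auto
  finally show ?thesis .
qed

lemma weight_mono:
  assumes "\<And>j. Poly_Mapping.lookup \<mu> j \<le> Poly_Mapping.lookup \<nu> j"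
  shows "weight c \<mu> \<le> weight c \<nu>"
proof -
  have "Poly_Mapping.keys \<mu> \<subseteq> Poly_Mapping.keys \<nu>"
    using assms by (metis in_keys_iff le_zero_eq subsetI)
  then have "weight c \<mu> = (\<Sum>j\<in>Poly_Mapping.keys \<nu>. c j * Poly_Mapping.lookup \<mu> j)"
    by (intro weight_eq_sum) auto
  also have "\<dots> \<le> weight c \<nu>"
    unfolding weight_def by (intro sum_mono mult_left_mono assms) auto
  finally show ?thesis .
qed

lemma coeff_le_weight:
  assumes "j \<in> Poly_Mapping.keys \<nu>"
  shows "c j \<le> weight c \<nu>"
proof -
  have "c j \<le> c j * Poly_Mapping.lookup \<nu> j"
    using assms by (simp add: in_keys_iff Suc_le_eq)
  also have "\<dots> \<le> weight c \<nu>"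
    unfolding weight_def by (rule member_le_sum) (use assms in auto)
  finally show ?thesis .
qed

lemma diff_single_add_single:
  fixes \<nu> :: multi_index
  assumes "Poly_Mapping.lookup \<nu> j \<noteq> 0"
  shows "\<nu> - Poly_Mapping.single j 1 + Poly_Mapping.single j 1 = \<nu>"
  by (rule poly_mapping_eqI) (use assms in \<open>auto simp: lookup_add lookup_minus lookup_single when_def\<close>)

text \<open>Rankin's trick. Splitting on whether the last coordinate vanishes mirrors the identity
  \<open>1 / (1 - x) = 1 + x / (1 - x)\<close> for the last factor of the generating function.\<close>

lemma card_weight_le_bound:
  fixes z :: real
  assumes c: "\<And>j. 0 < c j" and z: "0 < z" "z < 1"
  shows "finite {\<nu>. Poly_Mapping.keys \<nu> \<subseteq> {..<J} \<and> weight c \<nu> \<le> m} \<and>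
    real (card {\<nu>. Poly_Mapping.keys \<nu> \<subseteq> {..<J} \<and> weight c \<nu> \<le> m}) * z ^ m
      \<le> (\<Prod>j<J. 1 / (1 - z ^ c j))"
proof (induction J arbitrary: m)
  case 0
  have "{\<nu>. Poly_Mapping.keys \<nu> \<subseteq> {..<0} \<and> weight c \<nu> \<le> m} = {0}"
    by (auto simp: weight_def)
  then show ?case using z by (simp add: power_le_one)
next
  case (Suc J)
  define S where "S I m = {\<nu>. Poly_Mapping.keys \<nu> \<subseteq> {..<I} \<and> weight c \<nu> \<le> m}" for I m
  define G where "G I = (\<Prod>j<I. 1 / (1 - z ^ c j))" for I
  have less1: "z ^ c j < 1" for j using c[of j] z by (simp add: power_Suc_less_one power_less_one_iff)
  have G0: "0 < G I" for I unfolding G_def by (intro prod_pos) (use less1 in auto)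
  have GS: "G (Suc J) = G J + z ^ c J * G (Suc J)"
    using less1[of J] by (simp add: G_def field_simps)
  have IH: "finite (S J m)" "real (card (S J m)) * z ^ m \<le> G J" for m
    using Suc.IH[of m] by (auto simp: S_def G_def)
  \<comment> \<open>With \<open>J\<close> fixed, a second induction runs on \<open>m\<close>: taking
    one unit off a nonzero coordinate \<open>J\<close> keeps the support inside
    \<open>{..<Suc J}\<close> and lowers the weight by \<open>c J\<close>, which is
    positive.\<close>
  have "finite (S (Suc J) m) \<and> real (card (S (Suc J) m)) * z ^ m \<le> G (Suc J)"
  proof (induction m rule: less_induct)
    case (less m)
    let ?T = "{\<nu> \<in> S (Suc J) m. Poly_Mapping.lookup \<nu> J \<noteq> 0}"
    let ?g = "\<lambda>\<nu>. \<nu> + Poly_Mapping.single J 1"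
    have "\<nu> \<in> S J m" if "\<nu> \<in> S (Suc J) m" "Poly_Mapping.lookup \<nu> J = 0" for \<nu>
      using that unfolding S_def lessThan_Suc by (auto simp: in_keys_iff)
    then have split: "S (Suc J) m \<subseteq> S J m \<union> ?T" by auto
    show ?case
    proof (cases "c J \<le> m")
      case True
      have T: "?T \<subseteq> ?g ` S (Suc J) (m - c J)"
      proof
        fix \<nu> assume \<nu>: "\<nu> \<in> ?T"
        let ?\<mu> = "\<nu> - Poly_Mapping.single J 1"
        have eq: "\<nu> = ?g ?\<mu>" using diff_single_add_single \<nu> by (metis (mono_tags, lifting) mem_Collect_eq)
        have "weight c \<nu> = weight c ?\<mu> + c J"
          by (subst eq) (rule weight_add_single)
        moreover have "Poly_Mapping.keys ?\<mu> \<subseteq> Poly_Mapping.keys \<nu>"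
          by (auto simp: in_keys_iff lookup_minus)
        ultimately have "?\<mu> \<in> S (Suc J) (m - c J)" using \<nu> unfolding S_def by auto
        then show "\<nu> \<in> ?g ` S (Suc J) (m - c J)" using eq by blast
      qed
      have IH2: "finite (S (Suc J) (m - c J))"
          "real (card (S (Suc J) (m - c J))) * z ^ (m - c J) \<le> G (Suc J)"
        using less.IH[of "m - c J"] c[of J] True by auto
      have "S (Suc J) m \<subseteq> S J m \<union> ?g ` S (Suc J) (m - c J)" using split T by blast
      moreover have "finite (S J m \<union> ?g ` S (Suc J) (m - c J))" using IH IH2 by simp
      ultimately have fin: "finite (S (Suc J) m)"
        and "card (S (Suc J) m) \<le> card (S J m \<union> ?g ` S (Suc J) (m - c J))"
        by (auto intro: finite_subset card_mono)
      then have "card (S (Suc J) m) \<le> card (S J m) + card (S (Suc J) (m - c J))"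
        using card_Un_le[of "S J m" "?g ` S (Suc J) (m - c J)"]
          card_image_le[OF IH2(1), of ?g] by linarith
      then have "real (card (S (Suc J) m)) * z ^ m
          \<le> (real (card (S J m)) + real (card (S (Suc J) (m - c J)))) * z ^ m"
        using z by (intro mult_right_mono) auto
      also have "\<dots> = real (card (S J m)) * z ^ m
            + z ^ c J * (real (card (S (Suc J) (m - c J))) * z ^ (m - c J))"
        using True by (simp add: algebra_simps flip: power_add)
      also have "\<dots> \<le> G J + z ^ c J * G (Suc J)"
        using IH IH2 z by (intro add_mono mult_left_mono) auto
      finally show ?thesis using fin GS by simp
    next
      case False
      have "?T = {}"
      proof (rule ccontr)
        assume "?T \<noteq> {}"
        then obtain \<nu> where "Poly_Mapping.lookup \<nu> J \<noteq> 0" "weight c \<nu> \<le> m"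
          unfolding S_def by blast
        then show False using False coeff_le_weight[of J \<nu> c] by (simp add: in_keys_iff)
      qed
      then have sub: "S (Suc J) m \<subseteq> S J m" using split by blast
      then have "real (card (S (Suc J) m)) * z ^ m \<le> real (card (S J m)) * z ^ m"
        using IH z by (intro mult_right_mono) (auto intro: card_mono)
      also have "\<dots> \<le> G J" by (rule IH)
      also have "\<dots> \<le> G (Suc J)" using GS G0[of "Suc J"] z by (smt (verit) mult_nonneg_nonneg zero_le_power)
      finally show ?thesis using sub IH finite_subset by blast
    qed
  qed
  then show ?case by (simp add: S_def G_def)
qed

section \<open>Dyadic blocks\<close>

text \<open>The number of the block that holds the one-based position \<open>j + 1\<close>. For k at
  least 2 the zero-based block is 2^(k-1) \<le> j < 2^k; since \<open>floor_log 0 = 0\<close>, index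
  0 joins index 1 in the irregular first block.\<close>

definition level :: "nat \<Rightarrow> nat" where
  "level j = Suc (floor_log j)"

lemma level_eqI:
  assumes "2 ^ k \<le> j" "j < 2 ^ Suc k"
  shows "level j = Suc k"
  unfolding level_def using assms by (simp add: floor_log_eqI)

lemma less_two_power_level: "j < 2 ^ level j"
  by (cases "j = 0") (use floor_log_exp2_gt[of j] in \<open>auto simp: level_def\<close>)

lemma mem_block_iff: "1 \<le> k \<and> Suc j \<in> block k \<longleftrightarrow> k = level j"
proof
  assume k: "1 \<le> k \<and> Suc j \<in> block k"
  show "k = level j"
  proof (cases "k = 1")
    case True
    then have "j = 0 \<or> j = 1" using k by (auto simp: block_def)
    then show ?thesis using True level_eqI[of 0 1] by (auto simp: level_def)
  next
    case False
    then obtain i where "k = Suc i" using k by (cases k) auto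
    then show ?thesis using k False level_eqI[of i j] by (auto simp: block_def)
  qed
next
  assume k: "k = level j"
  show "1 \<le> k \<and> Suc j \<in> block k"
  proof (cases "floor_log j = 0")
    case True
    then have "j < 2" using less_two_power_level[of j] by (simp add: level_def)
    then show ?thesis using True k by (auto simp: level_def block_def)
  next
    case False
    then have "j \<noteq> 0" by (metis floor_log_zero)
    then have "2 ^ floor_log j \<le> j" by (simp add: floor_log_exp2_le)
    then show ?thesis using less_two_power_level[of j] False k
      by (auto simp: level_def block_def)
  qed
qed

lemma rho_star_eq: "rho_star s j = 2 powr (real (level j) * s)"
  unfolding rho_star_def mem_block_iff by simp

lemma mpow_rho_star: "mpow (rho_star s) \<nu> = 2 powr (s * real (weight level \<nu>))"
proof -
  have "mpow (rho_star s) \<nu>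
      = (\<Prod>j\<in>Poly_Mapping.keys \<nu>. 2 powr (s * real (level j * Poly_Mapping.lookup \<nu> j)))"
    unfolding mpow_def rho_star_eq
    by (rule prod.cong) (auto simp: powr_realpow[symmetric] powr_powr algebra_simps)
  also have "\<dots> = 2 powr (s * real (weight level \<nu>))"
    by (simp add: weight_def powr_sum[symmetric] sum_distrib_left)
  finally show ?thesis .
qed

section \<open>Counting multi-indices for the dyadic weights\<close>

text \<open>The 2^k indices from 2^k up to 2^(k+1) - 1 share the level k + 1 and contribute
  (2z)^(k+1) together. The separate term 2z belongs to index 0.\<close>

lemma sum_power_level:
  fixes z :: real
  shows "(\<Sum>j<2 ^ K. 2 * z ^ level j) = 2 * z + (\<Sum>k<K. (2 * z) ^ Suc k)"
proof (induction K)
  case 0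
  show ?case by (simp add: level_def)
next
  case (Suc K)
  have "{..<2 ^ Suc K} = {..<2 ^ K} \<union> {2 ^ K..<2 ^ Suc K :: nat}" by auto
  then have "(\<Sum>j<2 ^ Suc K. 2 * z ^ level j)
      = (\<Sum>j<2 ^ K. 2 * z ^ level j) + (\<Sum>j=2 ^ K..<2 ^ Suc K. 2 * z ^ level j)"
    by (simp add: sum.union_disjoint ivl_disj_int_one(2))
  also have "(\<Sum>j=2 ^ K..<2 ^ Suc K. 2 * z ^ level j) = (\<Sum>j=2 ^ K..<2 ^ Suc K::nat. 2 * z ^ Suc K)"
    by (rule sum.cong) (auto simp: level_eqI)
  also have "\<dots> = (2 * z) ^ Suc K" by (simp add: power_mult_distrib)
  finally show ?case using Suc by simp
qed

text \<open>Turns the product of the generating function into the exponential of a geometric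
  sum.\<close>

lemma inverse_one_minus_le_exp:
  fixes x :: real
  assumes "0 \<le> x" "x \<le> 1 / 2"
  shows "1 / (1 - x) \<le> exp (2 * x)"
proof -
  have "1 / (1 - x) = 1 + x / (1 - x)" using assms by (simp add: field_simps)
  also have "\<dots> \<le> exp (x / (1 - x))" by (rule exp_ge_add_one_self)
  also have "x / (1 - x) \<le> x / (1 / 2)" using assms by (intro divide_left_mono) auto
  finally show ?thesis by (simp add: mult.commute)
qed

lemma card_weight_level:
  fixes m :: nat
  defines "q \<equiv> sqrt (real m + 2)"
  shows "finite {\<nu>. weight level \<nu> \<le> m}" (is ?fin)
    and "real (card {\<nu>. weight level \<nu> \<le> m}) \<le> 2 powr (real m + 2 + 4 * q)" (is ?card)
proof -
  let ?N = "{\<nu>. weight level \<nu> \<le> m}"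
  have q: "0 < q" "q * q = real m + 2" by (simp_all add: q_def)
  \<comment> \<open>Just below the radius of convergence \<open>1 / 2\<close> of the generating function.\<close>
  define z where "z = q / (2 * (q + 1))"
  have z: "0 < z" "z < 1" "z \<le> 1 / 2" using q by (simp_all add: z_def field_simps)
  \<comment> \<open>Finitely many coordinates suffice: weight at most \<open>m\<close> forces every
    index in the support to have level at most \<open>m\<close>.\<close>
  have N: "?N = {\<nu>. Poly_Mapping.keys \<nu> \<subseteq> {..<2 ^ m} \<and> weight level \<nu> \<le> m}"
  proof -
    have "j < 2 ^ m" if "weight level \<nu> \<le> m" "j \<in> Poly_Mapping.keys \<nu>" for j \<nu>
    proof -
      have "level j \<le> m" using coeff_le_weight[OF that(2), of level] that(1) by simp
      then have "(2::nat) ^ level j \<le> 2 ^ m" by simp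
      then show ?thesis using less_two_power_level[of j] by linarith
    qed
    then show ?thesis by auto
  qed
  have *: "finite ?N" "real (card ?N) * z ^ m \<le> (\<Prod>j<2 ^ m. 1 / (1 - z ^ level j))"
    using card_weight_le_bound[of level z "2 ^ m" m] z by (auto simp: N level_def)
  show ?fin by (rule *)
  have "(\<Prod>j<2 ^ m. 1 / (1 - z ^ level j)) \<le> (\<Prod>j<2 ^ m. exp (2 * z ^ level j))"
  proof (rule prod_mono)
    fix j
    have "z ^ level j \<le> z" using z by (simp add: level_def mult_left_le power_le_one)
    then show "0 \<le> 1 / (1 - z ^ level j) \<and> 1 / (1 - z ^ level j) \<le> exp (2 * z ^ level j)"
      using z by (intro conjI inverse_one_minus_le_exp) auto
  qed
  also have "\<dots> = exp (2 * z + (\<Sum>k<m. (2 * z) ^ Suc k))"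
    by (simp add: exp_sum[symmetric] sum_power_level)
  \<comment> \<open>Here 2z = q/(q+1), so the full geometric series 2z/(1-2z) equals
    \<open>q\<close>, and the extra term 2z is at most 1.\<close>
  also have "\<dots> \<le> exp (1 + q)"
  proof -
    have "(\<Sum>k<m. (2 * z) ^ k) \<le> 1 / (1 - 2 * z)"
    proof -
      have "2 * z < 1" using q by (simp add: z_def field_simps)
      then show ?thesis using z by (subst sum_gp_strict) (auto simp: divide_right_mono)
    qed
    then have "2 * z * (\<Sum>k<m. (2 * z) ^ k) \<le> 2 * z * (1 / (1 - 2 * z))"
      using z by (intro mult_left_mono) auto
    also have "\<dots> = q" using q by (simp add: z_def field_simps)
    finally show ?thesis using z by (simp add: sum_distrib_left)
  qed
  finally have "real (card ?N) * z ^ m \<le> exp (1 + q)" using *(2) by linarith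
  then have "real (card ?N) \<le> exp (1 + q) * (1 / z) ^ m"
    using z by (simp add: field_simps)
  also have "1 / z = 2 * (1 + 1 / q)" using q by (simp add: z_def field_simps)
  also have "(2 * (1 + 1 / q)) ^ m \<le> (2 * exp (1 / q)) ^ m"
    using q by (intro power_mono mult_left_mono exp_ge_add_one_self) auto
  also have "(2 * exp (1 / q)) ^ m = 2 ^ m * exp (real m / q)"
    by (simp add: power_mult_distrib exp_of_nat_mult[symmetric])
  \<comment> \<open>Since q^2 = m + 2, the choice of \<open>q\<close> balances the two losses: the
    series costs about \<open>q\<close> in the exponent, and z^(-m) costs at most \<open>q\<close>
    beyond 2^m.\<close>
  also have "real m / q \<le> q" using q by (simp add: field_simps)
  finally have "real (card ?N) \<le> exp (1 + q) * (2 ^ m * exp q)" by simp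
  also have "\<dots> = 2 ^ m * exp (1 + 2 * q)" by (simp flip: exp_add)
  also have "exp (1 + 2 * q) \<le> 2 powr (2 + 4 * q)"
  proof -
    have "1 + 2 * q \<le> (2 + 4 * q) * (2 / 3)" using q by simp
    also have "\<dots> \<le> (2 + 4 * q) * ln 2"
      using q ln2_ge_two_thirds by (intro mult_left_mono) auto
    finally show ?thesis by (simp add: powr_def)
  qed
  finally show ?card by (simp add: powr_add powr_realpow)
qed

section \<open>The decreasing rearrangement\<close>

lemma infinite_multi_index: "infinite (UNIV :: multi_index set)"
proof
  assume fin: "finite (UNIV :: multi_index set)"
  have "inj (\<lambda>n. Poly_Mapping.single (0::nat) (n::nat))"
    by (rule injI) (metis lookup_single_eq)
  from range_inj_infinite[OF this] show False using finite_subset[OF subset_UNIV fin] by simp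
qed

text \<open>Decreasing reciprocals mean increasing weights, and two sorted enumerations have the
  same \<open>n\<close>-th weight because both are governed by the same counting function. Hence the
  description in \<open>delta\<close> is unique.\<close>

lemma delta_rho_star:
  assumes s: "s > 0" and n: "1 \<le> n"
    and e: "bij_betw e {1..} UNIV"
    and sorted: "\<And>i j. 1 \<le> i \<Longrightarrow> i \<le> j \<Longrightarrow> weight level (e i) \<le> weight level (e j)"
  shows "delta (rho_star s) n = 2 powr (- s * real (weight level (e n)))"
proof -
  have inv: "1 / mpow (rho_star s) \<nu> = 2 powr (- s * real (weight level \<nu>))" for \<nu>
    by (simp add: mpow_rho_star powr_minus_divide)
  have le_iff: "1 / mpow (rho_star s) \<mu> \<le> 1 / mpow (rho_star s) \<nu>
      \<longleftrightarrow> weight level \<nu> \<le> weight level \<mu>" for \<mu> \<nu>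
    unfolding inv using s by simp
  show ?thesis
    unfolding delta_def le_iff
  proof (rule the_equality, goal_cases)
    case 1
    show ?case using e sorted by (intro exI[of _ e]) (simp add: inv)
  next
    case (2 x)
    then obtain e' where e': "bij_betw e' {1..} UNIV"
      "\<And>i j. 1 \<le> i \<Longrightarrow> i \<le> j \<Longrightarrow> weight level (e' i) \<le> weight level (e' j)"
      and x: "x = 1 / mpow (rho_star s) (e' n)" by blast
    have "weight level (e' n) \<le> m \<longleftrightarrow> weight level (e n) \<le> m" for m
      using sorted_enumeration_le_iff[where f = "weight level", OF e sorted card_weight_level(1) n]
        sorted_enumeration_le_iff[where f = "weight level", OF e' card_weight_level(1) n] by blast
    then have "weight level (e' n) = weight level (e n)" by (meson order_antisym order_refl)
    then show ?case using x inv by simp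
  qed
qed

section \<open>Truncation error\<close>

lemma lp_norm_1: "lp_norm 1 a = (\<Sum>\<^sub>\<infinity>i. ennreal \<bar>a i\<bar>)"
  by (auto simp: lp_norm_def Let_def ennreal_enn2real_if)

lemma norm_mpow_le_1: "y \<in> Y \<Longrightarrow> \<bar>mpow y \<nu>\<bar> \<le> 1"
  unfolding mpow_def abs_prod
  by (rule prod_le_1) (auto simp: Y_def power_abs abs_le_iff power_le_one minus_le_iff)

text \<open>Outside \<Lambda> each term has norm at most \<open>d\<close> times its share of the
  weighted l1 norm, so what a partial sum adds to the truncation is at most \<open>d\<close>.
  Partial sums along \<open>e\<close> eventually contain \<Lambda>, and the bound passes to the
  limit.\<close>

lemma approx_error_le:
  fixes u :: "(nat \<Rightarrow> real) \<Rightarrow> 'a::banach"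
  assumes rep: "represents t u" and en: "bij (e :: nat \<Rightarrow> multi_index)"
    and norm: "(\<Sum>\<^sub>\<infinity>\<nu>. ennreal \<bar>mpow \<rho> \<nu> * norm (t \<nu>)\<bar>) \<le> 1"
    and \<rho>: "\<And>\<nu>. 0 < mpow \<rho> \<nu>" and fin: "finite \<Lambda>"
    and d: "0 \<le> d" "\<And>\<nu>. \<nu> \<notin> \<Lambda> \<Longrightarrow> 1 / mpow \<rho> \<nu> \<le> d" and y: "y \<in> Y"
  shows "norm (u y - (\<Sum>\<nu>\<in>\<Lambda>. mpow y \<nu> *\<^sub>R t \<nu>)) \<le> d"
proof -
  have fin_le: "(\<Sum>\<nu>\<in>A. mpow \<rho> \<nu> * norm (t \<nu>)) \<le> 1" if "finite A" for A
  proof -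
    have nn: "0 \<le> mpow \<rho> \<nu> * norm (t \<nu>)" for \<nu> using \<rho>[of \<nu>] by simp
    have "ennreal (\<Sum>\<nu>\<in>A. mpow \<rho> \<nu> * norm (t \<nu>)) = (\<Sum>\<nu>\<in>A. ennreal \<bar>mpow \<rho> \<nu> * norm (t \<nu>)\<bar>)"
      using nn by (subst sum_ennreal) (auto simp: abs_of_nonneg)
    also have "\<dots> = (\<Sum>\<^sub>\<infinity>\<nu>\<in>A. ennreal \<bar>mpow \<rho> \<nu> * norm (t \<nu>)\<bar>)" using that by simp
    also have "\<dots> \<le> (\<Sum>\<^sub>\<infinity>\<nu>. ennreal \<bar>mpow \<rho> \<nu> * norm (t \<nu>)\<bar>)"
      by (rule infsum_mono_neutral) (auto intro: nonneg_summable_on_complete)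
    also have "\<dots> \<le> 1" by (rule norm)
    finally show ?thesis by simp
  qed
  let ?P = "\<Sum>\<nu>\<in>\<Lambda>. mpow y \<nu> *\<^sub>R t \<nu>"
  have inj: "inj e" and "surj e" using en by (auto simp: bij_def)
  then have "finite (e -` \<Lambda>)" using fin finite_vimageI by blast
  then obtain N where N: "\<And>i. i \<in> e -` \<Lambda> \<Longrightarrow> i < N"
    by (auto simp: finite_nat_set_iff_bounded)
  have "norm ((\<Sum>i<n. mpow y (e i) *\<^sub>R t (e i)) - ?P) \<le> d" if "N \<le> n" for n
  proof -
    let ?A = "e ` {..<n}"
    have sub: "\<Lambda> \<subseteq> ?A"
    proof
      fix \<nu> assume "\<nu> \<in> \<Lambda>"
      moreover obtain i where "\<nu> = e i" using \<open>surj e\<close> by (metis surjD)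
      ultimately show "\<nu> \<in> ?A" using N[of i] that by simp
    qed
    have "(\<Sum>i<n. mpow y (e i) *\<^sub>R t (e i)) = (\<Sum>\<nu>\<in>?A. mpow y \<nu> *\<^sub>R t \<nu>)"
      using inj by (subst sum.reindex) (auto intro: inj_on_subset)
    then have "(\<Sum>i<n. mpow y (e i) *\<^sub>R t (e i)) - ?P = (\<Sum>\<nu>\<in>?A - \<Lambda>. mpow y \<nu> *\<^sub>R t \<nu>)"
      using sub by (simp add: sum_diff)
    also have "norm \<dots> \<le> (\<Sum>\<nu>\<in>?A - \<Lambda>. d * (mpow \<rho> \<nu> * norm (t \<nu>)))"
    proof (rule sum_norm_le)
      fix \<nu> assume \<nu>: "\<nu> \<in> ?A - \<Lambda>"
      have "norm (mpow y \<nu> *\<^sub>R t \<nu>) \<le> 1 * norm (t \<nu>)"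
        unfolding norm_scaleR by (intro mult_right_mono norm_mpow_le_1 y) auto
      also have "1 \<le> d * mpow \<rho> \<nu>" using d(2)[of \<nu>] \<rho>[of \<nu>] \<nu> by (simp add: field_simps)
      then have "1 * norm (t \<nu>) \<le> d * mpow \<rho> \<nu> * norm (t \<nu>)" by (intro mult_right_mono) auto
      finally show "norm (mpow y \<nu> *\<^sub>R t \<nu>) \<le> d * (mpow \<rho> \<nu> * norm (t \<nu>))" by (simp add: mult.assoc)
    qed
    also have "\<dots> = d * (\<Sum>\<nu>\<in>?A - \<Lambda>. mpow \<rho> \<nu> * norm (t \<nu>))" by (simp add: sum_distrib_left)
    also have "\<dots> \<le> d * 1" using d(1) by (intro mult_left_mono fin_le) auto
    finally show ?thesis by simp
  qed
  moreover have "(\<lambda>n. \<Sum>i<n. mpow y (e i) *\<^sub>R t (e i)) \<longlonglongrightarrow> u y"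
    using tendsto_uniform_limitI[OF rep[unfolded represents_def, rule_format, OF en] y] .
  then have "(\<lambda>n. norm ((\<Sum>i<n. mpow y (e i) *\<^sub>R t (e i)) - ?P)) \<longlonglongrightarrow> norm (u y - ?P)"
    by (intro tendsto_intros)
  ultimately show ?thesis by (meson Lim_bounded)
qed

text \<open>The expansion of \<open>u\<close> truncated to \<Lambda> serves as approximant; one
  \<Lambda> works for the whole ball.\<close>

lemma E_width_U_ball_le:
  assumes \<rho>: "\<And>\<nu>. 0 < mpow \<rho> \<nu>" and \<Lambda>: "\<Lambda> \<in> lower_sets n"
    and d: "0 \<le> d" "\<And>\<nu>. \<nu> \<notin> \<Lambda> \<Longrightarrow> 1 / mpow \<rho> \<nu> \<le> d"
    and en: "bij (e :: nat \<Rightarrow> multi_index)"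
  shows "E_width n (U_ball \<rho> 1 :: ((nat \<Rightarrow> real) \<Rightarrow> 'a::banach) set) \<le> ennreal d"
  unfolding E_width_def
proof (rule INF_lower2[OF \<Lambda>], rule SUP_least)
  fix u :: "(nat \<Rightarrow> real) \<Rightarrow> 'a"
  assume u: "u \<in> U_ball \<rho> 1"
  define t where "t = (THE t. represents t u)"
  have rep: "represents t u"
    using u theI'[of "\<lambda>t. represents t u"] by (auto simp: U_ball_def B_space_def t_def)
  have norm: "(\<Sum>\<^sub>\<infinity>\<nu>. ennreal \<bar>mpow \<rho> \<nu> * norm (t \<nu>)\<bar>) \<le> 1"
    using u by (simp add: U_ball_def B_norm_def lp_norm_1 t_def)
  let ?P = "\<lambda>y. \<Sum>\<nu>\<in>\<Lambda>. mpow y \<nu> *\<^sub>R t \<nu>"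
  have "?P \<in> poly_space \<Lambda>" by (auto simp: poly_space_def)
  moreover have "sup_norm (\<lambda>y. u y - ?P y) \<le> ennreal d"
    unfolding sup_norm_def
  proof (rule SUP_least, rule ennreal_leI)
    fix y assume "y \<in> Y"
    then show "norm (u y - ?P y) \<le> d"
      using \<Lambda> by (intro approx_error_le[OF rep en norm \<rho> _ d]) (auto simp: lower_sets_def)
  qed
  ultimately show "(INF P\<in>poly_space \<Lambda>. sup_norm (\<lambda>y. u y - P y)) \<le> ennreal d"
    by (rule INF_lower2[where i = ?P])
qed

section \<open>The two bounds\<close>

theorem corollary5p4:
  fixes s :: real
  assumes "s > 0"
  shows "\<forall>n::nat. 2 \<le> n \<longrightarrow>
      delta (rho_star s) n
        \<le> 2 powr (- 6 * s) * real n powr (- s)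
            * real n powr (4 * s * sqrt (4 + log 2 (real n)) / log 2 (real n)) \<and>
      E_width n (U_ball (rho_star s) 1 :: ((nat \<Rightarrow> real) \<Rightarrow> 'a::banach) set)
        \<le> ennreal (2 powr (- 6 * s) * real n powr (- s)
            * real n powr (4 * s * sqrt (4 + log 2 (real n)) / log 2 (real n)))"
proof (intro allI impI)
  fix n :: nat
  assume n: "2 \<le> n"
  let ?w = "weight level"
  let ?B = "2 powr (- 6 * s) * real n powr (- s)
            * real n powr (4 * s * sqrt (4 + log 2 (real n)) / log 2 (real n))"
  obtain e :: "nat \<Rightarrow> multi_index" where e: "bij e" "\<And>i j. i \<le> j \<Longrightarrow> ?w (e i) \<le> ?w (e j)"
    using sorted_enumeration_exists[OF card_weight_level(1) infinite_multi_index] by blast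
  \<comment> \<open>\<open>delta\<close> enumerates from 1, \<open>represents\<close> from
    0.\<close>
  define e1 where "e1 i = e (i - 1)" for i
  have "bij_betw (\<lambda>i. i - 1) {1..} (UNIV :: nat set)"
    by (rule bij_betwI[where g = Suc]) auto
  then have e1: "bij_betw e1 {1..} UNIV"
    using bij_betw_trans[of "\<lambda>i. i - 1" "{1..}" UNIV e UNIV] e(1)
    by (simp add: e1_def[abs_def] comp_def)
  have sorted: "?w (e1 i) \<le> ?w (e1 j)" if "1 \<le> i" "i \<le> j" for i j
    using e(2) that by (simp add: e1_def)
  define m where "m = ?w (e1 n)"
  have delta: "delta (rho_star s) n = 2 powr (- s * real m)"
    using delta_rho_star[OF assms _ e1 sorted, of n] n by (simp add: m_def)
  note rank_iff = sorted_enumeration_le_iff[where f = ?w, OF e1 sorted card_weight_level(1)]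
  define L where "L = log 2 (real n)"
  have L: "1 \<le> L" using n by (simp add: L_def le_log_iff)
  have nL: "real n = 2 powr L" using n by (simp add: L_def)
  have le_B: "2 powr (- s * real m) \<le> ?B"
  proof -
    define q x where "q = sqrt (real m + 2)" and "x = sqrt (4 + L)"
    have q: "0 < q" "q\<^sup>2 = real m + 2" and x2: "x\<^sup>2 = 4 + L"
      using L by (simp_all add: q_def x_def)
    have x: "2 \<le> x" unfolding x_def using L by (intro real_le_rsqrt) simp
    have "n \<le> card {\<nu>. ?w \<nu> \<le> m}" using rank_iff[of n m] n by (simp add: m_def)
    then have "real n \<le> real (card {\<nu>. ?w \<nu> \<le> m})" by simp
    also have "\<dots> \<le> 2 powr (real m + 2 + 4 * q)" unfolding q_def by (rule card_weight_level(2))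
    finally have "L \<le> real m + 2 + 4 * q" unfolding nL by simp
    then have "x\<^sup>2 \<le> (q + 2)\<^sup>2" using q x2 by (simp add: power2_sum)
    \<comment> \<open>As \<open>x\<close> is at least 2, this inequality can be squared again
      below.\<close>
    then have "x - 2 \<le> q" using q by (smt (verit) power2_le_imp_le)
    then have "(x - 2)\<^sup>2 \<le> q\<^sup>2" using x by (intro power_mono) auto
    then have "L + 6 - 4 * x \<le> real m" using q x2 by (simp add: power2_diff)
    then have "s * (L + 6 - 4 * x) \<le> s * real m" using assms by (intro mult_left_mono) auto
    \<comment> \<open>Writing 4sx as L * (4sx/L) produces the power of \<open>n\<close> in the
      claim; L is at least 1, so the division is harmless.\<close>
    then have "2 powr (- s * real m) \<le> 2 powr (- 6 * s + L * - s + L * (4 * s * x / L))"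
      using L by (simp add: algebra_simps)
    also have "\<dots> = 2 powr (- 6 * s) * (2 powr L) powr (- s) * (2 powr L) powr (4 * s * x / L)"
      by (simp only: powr_add powr_powr)
    also have "\<dots> = ?B" unfolding x_def L_def[symmetric] nL[symmetric] ..
    finally show ?thesis .
  qed
  \<comment> \<open>Cutting strictly below \<open>m\<close> gives a lower set whatever way ties are broken.\<close>
  have "{\<nu>. ?w \<nu> < m} \<in> lower_sets n"
  proof -
    have "finite {\<nu>. ?w \<nu> < m} \<and> card {\<nu>. ?w \<nu> < m} \<le> n"
    \<comment> \<open>For m = 0 the set is empty. Otherwise the \<open>n\<close>-th weight exceeds m
      - 1, so fewer than \<open>n\<close> multi-indices have weight at most m - 1.\<close>
    proof (cases m)
      case (Suc k)
      then have "\<not> ?w (e1 n) \<le> k" by (simp add: m_def)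
      then show ?thesis
        using card_weight_level(1)[of k] rank_iff[of n k] n by (simp add: Suc less_Suc_eq_le)
    qed simp
    moreover have "lower_set {\<nu>. ?w \<nu> < m}"
      unfolding lower_set_def using weight_mono le_less_trans by blast
    ultimately show ?thesis by (simp add: lower_sets_def)
  qed
  then have "E_width n (U_ball (rho_star s) 1 :: ((nat \<Rightarrow> real) \<Rightarrow> 'a) set)
      \<le> ennreal (2 powr (- s * real m))"
    using e(1) assms
    by (intro E_width_U_ball_le) (auto simp: mpow_rho_star powr_minus_divide[symmetric])
  also have "\<dots> \<le> ennreal ?B" using le_B by (rule ennreal_leI)
  finally show "delta (rho_star s) n \<le> ?B \<and>
      E_width n (U_ball (rho_star s) 1 :: ((nat \<Rightarrow> real) \<Rightarrow> 'a) set) \<le> ennreal ?B"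
    using le_B delta by simp
qed

end
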